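(* Let $h>0$ and $\alpha\in(0,2)$. Let $u=\{u_j\}_{j\in\mathbb{Z}}$ and $w=\{w_k\}_{k\in\mathbb{Z}}$ be real functions in $\ell^2(\mathbb{Z}_h)$, where $w_k=w_{-k}$ for all $k$, the series $\sum_{k\neq 0}w_k$ converges, and $w_0=-\sum_{k\neq 0}w_k$. Then the operator $$(-\Delta_h)^{\alpha/2}u_j=\sum_{k=-\infty}^{\infty}(u_j-u_{j-k})\,w_k,\qquad j\in\mathbb{Z},$$ is a multiplication in spectral space, that is, $$\widehat{(-\Delta_h)^{\alpha/2}u}(\xi)=M_h(\xi)\,\hat u(\xi),\qquad M_h(\xi)=-\frac{\hat w(\xi)}{h},\qquad \xi\in[-\pi/h,\pi/h],$$ where the identity means that $M_h\hat u$ is the function on $[-\pi/h,\pi/h]$ whose inverse semi-discrete Fourier transform is $(-\Delta_h)^{\alpha/2}u$: $$(-\Delta_h)^{\alpha/2}u_j=\frac{1}{2\pi}\int_{-\pi/h}^{\pi/h}e^{i\xi jh}M_h(\xi)\hat u(\xi)\,d\xi\quad\text{for all } j\in\mathbb{Z}.$$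
   Context: Let $\mathbb{Z}_h=\{jh: j\in\mathbb{Z}\}$ and $x_j=jh$. A function on $\mathbb{Z}_h$ is written $v=\{v_j\}_{j\in\mathbb{Z}}$ with $v_j=v(x_j)$, and $\ell^2(\mathbb{Z}_h)=\{v:\mathbb{Z}_h\to\mathbb{R} : h\sum_j|v_j|^2<\infty\}$. The semi-discrete Fourier transform of $v\in\ell^2(\mathbb{Z}_h)$ is $\hat v(\xi)=h\sum_{j=-\infty}^{\infty}e^{-i\xi x_j}v_j$ for $\xi\in I_h=[-\pi/h,\pi/h]$ (series converging in $L^2(I_h)$). Its inverse is $v_j=\frac{1}{2\pi}\int_{-\pi/h}^{\pi/h}e^{i\xi x_j}\hat v(\xi)\,d\xi$. The sequence $w$ is transformed in the same way, with $w_k$ regarded as its value at $x_k$. Bilateral infinite sums over $k$ are understood as limits of the symmetric partial sums over $|k|\le N$. The parameter $\alpha$ enters only as a label of the operator. *)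

theory Defs
  imports "HOL-Analysis.Analysis"
begin

text \<open>A function on the grid \<open>h\<int>\<close> is represented by the sequence \<open>v :: int \<Rightarrow> real\<close> of its values
  \<open>v j\<close> at the grid points \<open>x\<^sub>j = j h\<close>.\<close>

definition grid_point :: "real \<Rightarrow> int \<Rightarrow> real" where
  "grid_point h j = of_int j * h"

definition ell2 :: "real \<Rightarrow> (int \<Rightarrow> real) set" where
  "ell2 h = {v. (\<lambda>j. h * \<bar>v j\<bar>\<^sup>2) summable_on UNIV}"

text \<open>Bilateral series over an index set \<open>A\<close> of integers: limits of the symmetric partial sums over
  \<open>\<bar>k\<bar> \<le> N\<close>. The convergence may be only conditional, so this is weaker than \<open>summable_on\<close>.\<close>

definition sym_partial_sum :: "(int \<Rightarrow> 'a::real_normed_vector) \<Rightarrow> int set \<Rightarrow> nat \<Rightarrow> 'a" where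
  "sym_partial_sum f A N = (\<Sum>k \<in> A \<inter> {- int N..int N}. f k)"

definition sym_summable :: "(int \<Rightarrow> 'a::real_normed_vector) \<Rightarrow> int set \<Rightarrow> bool" where
  "sym_summable f A \<longleftrightarrow> convergent (sym_partial_sum f A)"

definition sym_sum :: "(int \<Rightarrow> 'a::real_normed_vector) \<Rightarrow> int set \<Rightarrow> 'a" where
  "sym_sum f A = lim (sym_partial_sum f A)"

definition freq_interval :: "real \<Rightarrow> real set" where
  "freq_interval h = {- pi / h..pi / h}"

definition square_integrable_on :: "(real \<Rightarrow> complex) \<Rightarrow> real set \<Rightarrow> bool" where
  "square_integrable_on g S \<longleftrightarrow>
     set_borel_measurable lborel S g \<and> set_integrable lborel S (\<lambda>\<xi>. (cmod (g \<xi>))\<^sup>2)"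

text \<open>\<open>g\<close> is a representative of the semi-discrete Fourier transform of \<open>v\<close>: the partial sums of
  \<open>h \<Sum>\<^sub>j exp (- i \<xi> x\<^sub>j) v\<^sub>j\<close> converge to \<open>g\<close> in \<open>L\<^sup>2\<close> of the frequency interval.\<close>

definition is_sdft :: "real \<Rightarrow> (int \<Rightarrow> real) \<Rightarrow> (real \<Rightarrow> complex) \<Rightarrow> bool" where
  "is_sdft h v g \<longleftrightarrow>
     square_integrable_on g (freq_interval h) \<and>
     (\<lambda>N. LINT \<xi>:freq_interval h|lborel.
        (cmod (of_real h *
               sym_partial_sum (\<lambda>j. exp (- \<i> * of_real (\<xi> * grid_point h j)) * of_real (v j)) UNIV N
               - g \<xi>))\<^sup>2) \<longlonglongrightarrow> 0"

text \<open>The transform is an \<open>L\<^sup>2\<close> class, so it is determined only up to a null set; \<open>sdft h v\<close> is an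
  arbitrary representative.\<close>

definition sdft :: "real \<Rightarrow> (int \<Rightarrow> real) \<Rightarrow> real \<Rightarrow> complex" where
  "sdft h v = (SOME g. is_sdft h v g)"

definition inverse_sdft :: "real \<Rightarrow> (real \<Rightarrow> complex) \<Rightarrow> int \<Rightarrow> complex" where
  "inverse_sdft h g j =
     1 / (2 * of_real pi) *
     (LINT \<xi>:freq_interval h|lborel. exp (\<i> * of_real (\<xi> * grid_point h j)) * g \<xi>)"

text \<open>The discrete operator \<open>(-\<Delta>\<^sub>h)\<^bsup>\<alpha>/2\<^esup>\<close> with weights \<open>w\<close>. The parameter \<open>\<alpha>\<close> is only a label: neither
  it nor \<open>h\<close> enters the formula otherwise than through \<open>w\<close>.\<close>

definition frac_laplacian_term :: "(int \<Rightarrow> real) \<Rightarrow> (int \<Rightarrow> real) \<Rightarrow> int \<Rightarrow> int \<Rightarrow> real" where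
  "frac_laplacian_term w u j k = (u j - u (j - k)) * w k"

definition frac_laplacian :: "real \<Rightarrow> (int \<Rightarrow> real) \<Rightarrow> (int \<Rightarrow> real) \<Rightarrow> int \<Rightarrow> real" where
  "frac_laplacian \<alpha> w u j = sym_sum (frac_laplacian_term w u j) UNIV"

definition multiplier :: "real \<Rightarrow> (int \<Rightarrow> real) \<Rightarrow> real \<Rightarrow> complex" where
  "multiplier h w \<xi> = - sdft h w \<xi> / of_real h"

end

theory Submission
  imports Defs
begin

text \<open>On the circle of frequencies the characters \<open>\<chi>\<^sub>j(\<xi>) = exp (i \<xi> j h)\<close> are orthogonal, so Parseval and
  the completeness of \<open>L\<^sup>2\<close> (Riesz--Fischer) show that every \<open>v\<close> in \<open>\<ell>\<^sup>2\<close> has a transform, and continuity of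
  the inner product shows that \<open>inverse_sdft\<close> inverts it. Because \<open>w 0 = - \<Sum>\<^bsub>k \<noteq> 0\<^esub> w k\<close>, the operator is minus
  the convolution \<open>\<Sum>\<^sub>k w k * u (j - k)\<close>. Let \<open>U\<close> and \<open>W\<close> be the
  transforms of \<open>u\<close> and \<open>w\<close>. Replacing only \<open>W\<close> by its partial sums in \<open>\<integral> \<chi>\<^sub>j W U\<close> and inverting \<open>U\<close> termwise
  yields exactly the symmetric partial sums of this convolution, so their convergence comes for free.\<close>

section \<open>Square integrable functions\<close>

text \<open>AM-GM dominates the product pointwise by the integrable sum of the two squares.\<close>

lemma integrable_mult_of_square_integrable:
  fixes f g :: "'a \<Rightarrow> complex"
  assumes [measurable]: "f \<in> borel_measurable M" "g \<in> borel_measurable M"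
    and f: "integrable M (\<lambda>x. (cmod (f x))\<^sup>2)" and g: "integrable M (\<lambda>x. (cmod (g x))\<^sup>2)"
  shows "integrable M (\<lambda>x. f x * g x)"
proof (rule Bochner_Integration.integrable_bound)
  show "integrable M (\<lambda>x. (cmod (f x))\<^sup>2 + (cmod (g x))\<^sup>2)"
    using f g by simp
  show "AE x in M. norm (f x * g x) \<le> norm ((cmod (f x))\<^sup>2 + (cmod (g x))\<^sup>2)"
  proof (rule AE_I2)
    fix x
    have "2 * cmod (f x) * cmod (g x) \<le> (cmod (f x))\<^sup>2 + (cmod (g x))\<^sup>2"
      by (rule sum_squares_bound)
    moreover have "0 \<le> cmod (f x) * cmod (g x)" by simp
    ultimately have "cmod (f x) * cmod (g x) \<le> (cmod (f x))\<^sup>2 + (cmod (g x))\<^sup>2"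
      by linarith
    then show "norm (f x * g x) \<le> norm ((cmod (f x))\<^sup>2 + (cmod (g x))\<^sup>2)"
      by (simp add: norm_mult)
  qed
qed measurable

text \<open>The inequality for \<open>ennreal\<close> integrals descends to the reals, since
  integrability makes all three integrals finite. The pairing carries no conjugate, which is the
  form needed for products of transforms.\<close>

lemma Cauchy_Schwarz_integral:
  fixes f g :: "'a \<Rightarrow> complex"
  assumes [measurable]: "f \<in> borel_measurable M" "g \<in> borel_measurable M"
    and f: "integrable M (\<lambda>x. (cmod (f x))\<^sup>2)" and g: "integrable M (\<lambda>x. (cmod (g x))\<^sup>2)"
  shows "(cmod (\<integral>x. f x * g x \<partial>M))\<^sup>2 \<le> (\<integral>x. (cmod (f x))\<^sup>2 \<partial>M) * (\<integral>x. (cmod (g x))\<^sup>2 \<partial>M)"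
proof -
  have fg: "integrable M (\<lambda>x. cmod (f x) * cmod (g x))"
    using integrable_norm[OF integrable_mult_of_square_integrable[OF assms]] by (simp add: norm_mult)
  have "(\<integral>\<^sup>+x. ennreal (cmod (f x)) * ennreal (cmod (g x)) \<partial>M)\<^sup>2
      \<le> (\<integral>\<^sup>+x. (ennreal (cmod (f x)))\<^sup>2 \<partial>M) * (\<integral>\<^sup>+x. (ennreal (cmod (g x)))\<^sup>2 \<partial>M)"
    by (rule Cauchy_Schwarz_nn_integral) measurable
  then have "ennreal ((\<integral>x. cmod (f x) * cmod (g x) \<partial>M)\<^sup>2)
      \<le> ennreal ((\<integral>x. (cmod (f x))\<^sup>2 \<partial>M) * (\<integral>x. (cmod (g x))\<^sup>2 \<partial>M))"
    using fg f g
    by (simp add: nn_integral_eq_integral ennreal_power ennreal_mult[symmetric])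
  then have *: "(\<integral>x. cmod (f x) * cmod (g x) \<partial>M)\<^sup>2
      \<le> (\<integral>x. (cmod (f x))\<^sup>2 \<partial>M) * (\<integral>x. (cmod (g x))\<^sup>2 \<partial>M)"
    by (subst (asm) ennreal_le_iff) auto
  have "cmod (\<integral>x. f x * g x \<partial>M) \<le> (\<integral>x. cmod (f x) * cmod (g x) \<partial>M)"
    using integral_norm_bound[of M "\<lambda>x. f x * g x"] by (simp add: norm_mult)
  then show ?thesis
    by (intro order_trans[OF power_mono *]) auto
qed

lemma integrable_square_diff:
  fixes f g :: "'a \<Rightarrow> complex"
  assumes [measurable]: "f \<in> borel_measurable M" "g \<in> borel_measurable M"
    and f: "integrable M (\<lambda>x. (cmod (f x))\<^sup>2)" and g: "integrable M (\<lambda>x. (cmod (g x))\<^sup>2)"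
  shows "integrable M (\<lambda>x. (cmod (f x - g x))\<^sup>2)"
proof (rule Bochner_Integration.integrable_bound)
  show "integrable M (\<lambda>x. 2 * (cmod (f x))\<^sup>2 + 2 * (cmod (g x))\<^sup>2)"
    using f g by simp
  show "AE x in M. norm ((cmod (f x - g x))\<^sup>2) \<le> norm (2 * (cmod (f x))\<^sup>2 + 2 * (cmod (g x))\<^sup>2)"
  proof (rule AE_I2)
    fix x
    have "(cmod (f x - g x))\<^sup>2 \<le> (cmod (f x) + cmod (g x))\<^sup>2"
      by (intro power_mono norm_triangle_ineq4) simp
    also have "\<dots> \<le> 2 * (cmod (f x))\<^sup>2 + 2 * (cmod (g x))\<^sup>2"
      using sum_squares_bound[of "cmod (f x)" "cmod (g x)"] by (simp add: power2_sum)
    finally show "norm ((cmod (f x - g x))\<^sup>2) \<le> norm (2 * (cmod (f x))\<^sup>2 + 2 * (cmod (g x))\<^sup>2)"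
      by simp
  qed
qed measurable

text \<open>Pairing with a fixed square integrable \<open>G\<close> is continuous in L2:
  Cauchy-Schwarz is applied to \<open>f n - F\<close> and \<open>G\<close>.\<close>

lemma tendsto_integral_mult_L2:
  fixes f :: "nat \<Rightarrow> 'a \<Rightarrow> complex" and F G :: "'a \<Rightarrow> complex"
  assumes [measurable]: "\<And>n. f n \<in> borel_measurable M" "F \<in> borel_measurable M" "G \<in> borel_measurable M"
    and f: "\<And>n. integrable M (\<lambda>x. (cmod (f n x))\<^sup>2)"
    and F: "integrable M (\<lambda>x. (cmod (F x))\<^sup>2)" and G: "integrable M (\<lambda>x. (cmod (G x))\<^sup>2)"
    and lim: "(\<lambda>n. \<integral>x. (cmod (f n x - F x))\<^sup>2 \<partial>M) \<longlonglongrightarrow> 0"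
  shows "(\<lambda>n. \<integral>x. f n x * G x \<partial>M) \<longlonglongrightarrow> (\<integral>x. F x * G x \<partial>M)"
proof -
  have bound: "(cmod ((\<integral>x. f n x * G x \<partial>M) - (\<integral>x. F x * G x \<partial>M)))\<^sup>2
      \<le> (\<integral>x. (cmod (f n x - F x))\<^sup>2 \<partial>M) * (\<integral>x. (cmod (G x))\<^sup>2 \<partial>M)" for n
  proof -
    have "(\<integral>x. f n x * G x \<partial>M) - (\<integral>x. F x * G x \<partial>M) = (\<integral>x. (f n x - F x) * G x \<partial>M)"
      using f F G
      by (subst Bochner_Integration.integral_diff[symmetric])
         (auto simp: algebra_simps intro!: integrable_mult_of_square_integrable)
    then show ?thesis
      using Cauchy_Schwarz_integral[of "\<lambda>x. f n x - F x" M G] integrable_square_diff[of "f n" M F] f F G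
      by simp
  qed
  have "(\<lambda>n. (cmod ((\<integral>x. f n x * G x \<partial>M) - (\<integral>x. F x * G x \<partial>M)))\<^sup>2) \<longlonglongrightarrow> 0"
    by (rule tendsto_sandwich[OF _ _ tendsto_const tendsto_mult_left_zero[OF lim]])
       (use bound in \<open>auto intro!: always_eventually\<close>)
  then have "(\<lambda>n. cmod ((\<integral>x. f n x * G x \<partial>M) - (\<integral>x. F x * G x \<partial>M))) \<longlonglongrightarrow> 0"
    by (auto dest: tendsto_real_sqrt)
  then show ?thesis
    by (simp add: tendsto_norm_zero_iff LIM_zero_iff)
qed

text \<open>Riesz-Fischer: along indices with geometrically small gaps the functions converge almost
  everywhere, and Fatou's lemma turns this pointwise limit into an L2 limit of the whole
  sequence.\<close>

lemma (in finite_measure) L2_complete: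
  fixes f :: "nat \<Rightarrow> 'a \<Rightarrow> complex"
  assumes [measurable]: "\<And>n. f n \<in> borel_measurable M"
    and int: "\<And>n. integrable M (\<lambda>x. (cmod (f n x))\<^sup>2)"
    and Cauchy: "\<And>e. e > 0 \<Longrightarrow> \<exists>N. \<forall>m\<ge>N. \<forall>n\<ge>N. (\<integral>x. (cmod (f m x - f n x))\<^sup>2 \<partial>M) < e"
  obtains g where "g \<in> borel_measurable M" "integrable M (\<lambda>x. (cmod (g x))\<^sup>2)"
    "(\<lambda>n. \<integral>x. (cmod (f n x - g x))\<^sup>2 \<partial>M) \<longlonglongrightarrow> 0"
proof -
  have nn: "(\<integral>\<^sup>+x. ennreal ((cmod (f m x - f n x))\<^sup>2) \<partial>M) = ennreal (\<integral>x. (cmod (f m x - f n x))\<^sup>2 \<partial>M)" for m n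
    by (intro nn_integral_eq_integral integrable_square_diff int) auto
  have "\<exists>N. \<forall>m\<ge>N. \<forall>n\<ge>N. (\<integral>x. (cmod (f m x - f n x))\<^sup>2 \<partial>M) < (1/4) ^ k" for k
    by (rule Cauchy) simp
  then obtain r where r: "\<And>k m n. m \<ge> r k \<Longrightarrow> n \<ge> r k \<Longrightarrow> (\<integral>x. (cmod (f m x - f n x))\<^sup>2 \<partial>M) < (1/4) ^ k"
    by metis
  \<comment> \<open>Summing the thresholds gives \<open>r k \<le> s m\<close> whenever
    \<open>k \<le> m\<close>, so \<open>s k\<close> and \<open>s (Suc k)\<close> both lie beyond
    \<open>r k\<close>.\<close>
  define s where "s k = sum r {..k}" for k :: nat
  have s: "r k \<le> s m" if "k \<le> m" for k m
    unfolding s_def using that by (intro member_le_sum) auto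
  define d where "d k x = cmod (f (s (Suc k)) x - f (s k) x)" for k x
  have [measurable]: "d k \<in> borel_measurable M" for k
    unfolding d_def by measurable
  \<comment> \<open>The weight \<open>2 ^ k\<close> balances two needs: against the decay
    \<open>(1/4) ^ k\<close> it leaves a summable bound, and it is large enough to recover
    summability of \<open>d k x\<close> from that of the weighted squares.\<close>
  have d: "(\<integral>\<^sup>+x. ennreal (2 ^ k * (d k x)\<^sup>2) \<partial>M) \<le> ennreal ((1/2) ^ k)" for k
  proof -
    have "(\<integral>\<^sup>+x. ennreal (2 ^ k * (d k x)\<^sup>2) \<partial>M) = ennreal (2 ^ k) * (\<integral>\<^sup>+x. ennreal ((d k x)\<^sup>2) \<partial>M)"
      by (subst nn_integral_cmult[symmetric]) (auto simp: ennreal_mult)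
    also have "(\<integral>\<^sup>+x. ennreal ((d k x)\<^sup>2) \<partial>M) \<le> ennreal ((1/4) ^ k)"
      unfolding d_def nn using r[of k "s (Suc k)" "s k"] s[of k k] s[of k "Suc k"]
      by (intro ennreal_leI) auto
    also have "ennreal (2 ^ k) * ennreal ((1/4) ^ k) = ennreal ((1/2) ^ k)"
      by (simp add: ennreal_mult[symmetric] power_mult_distrib[symmetric])
    finally show ?thesis by (simp add: mult_left_mono)
  qed
  have "(\<integral>\<^sup>+x. (\<Sum>k. ennreal (2 ^ k * (d k x)\<^sup>2)) \<partial>M) = (\<Sum>k. \<integral>\<^sup>+x. ennreal (2 ^ k * (d k x)\<^sup>2) \<partial>M)"
    by (rule nn_integral_suminf) measurable
  also have "\<dots> \<le> (\<Sum>k. ennreal ((1/2) ^ k))"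
    by (intro suminf_le d) auto
  also have "\<dots> = ennreal (\<Sum>k. (1/2) ^ k)"
    by (rule suminf_ennreal2) (auto simp: summable_geometric)
  finally have "(\<integral>\<^sup>+x. (\<Sum>k. ennreal (2 ^ k * (d k x)\<^sup>2)) \<partial>M) \<noteq> \<infinity>"
    by (auto simp: top_unique)
  then have "AE x in M. (\<Sum>k. ennreal (2 ^ k * (d k x)\<^sup>2)) \<noteq> \<infinity>"
    by (rule nn_integral_PInf_AE[rotated]) measurable
  then have conv: "AE x in M. convergent (\<lambda>k. f (s k) x)"
  proof eventually_elim
    case (elim x)
    have "summable (\<lambda>k. 2 ^ k * (d k x)\<^sup>2)"
      using elim by (intro summable_suminf_not_top) auto
    then have "summable (\<lambda>k. 2 ^ k * (d k x)\<^sup>2 + (1/2) ^ k)"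
      by (intro summable_add) (auto simp: summable_geometric)
    then have "summable (\<lambda>k. d k x)"
    proof (rule summable_comparison_test')
      fix k :: nat
      \<comment> \<open>AM-GM in the form \<open>2 d \<le> t d\<^sup>2 + 1/t\<close> with \<open>t = 2 ^ k\<close>\<close>
      have "0 \<le> (2 ^ k * d k x - 1)\<^sup>2 / 2 ^ k" by simp
      also have "\<dots> = 2 ^ k * (d k x)\<^sup>2 + (1/2) ^ k - 2 * d k x"
        by (simp add: field_simps power2_eq_square)
      finally have "2 * d k x \<le> 2 ^ k * (d k x)\<^sup>2 + (1/2) ^ k" by simp
      moreover have "d k x \<ge> 0" by (simp add: d_def)
      ultimately show "norm (d k x) \<le> 2 ^ k * (d k x)\<^sup>2 + (1/2) ^ k" by simp
    qed
    then have "summable (\<lambda>k. f (s (Suc k)) x - f (s k) x)"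
      unfolding d_def by (rule summable_norm_cancel)
    then have "convergent (\<lambda>n. \<Sum>k<n. f (s (Suc k)) x - f (s k) x)"
      by (simp add: summable_iff_convergent)
    then have "convergent (\<lambda>n. f (s n) x - f (s 0) x)"
      by (simp add: sum_lessThan_telescope[of "\<lambda>k. f (s k) x"])
    then show ?case
      by (simp add: convergent_diff_const_right_iff)
  qed
  \<comment> \<open>Where the sequence diverges, which happens only on a null set,
    \<open>lim\<close> is an unspecified value.\<close>
  define g where "g x = lim (\<lambda>k. f (s k) x)" for x
  have g[measurable]: "g \<in> borel_measurable M"
    unfolding g_def by measurable
  \<comment> \<open>Almost everywhere \<open>f n - g\<close> is the limit of
    \<open>f n - f (s m)\<close> as m grows, and for \<open>m \<ge> k\<close> the index
    \<open>s m\<close> is beyond \<open>r k\<close>. The bound holds for every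
    \<open>n \<ge> r k\<close>, hence beyond the chosen indices.\<close>
  have Fatou: "(\<integral>\<^sup>+x. ennreal ((cmod (f n x - g x))\<^sup>2) \<partial>M) \<le> ennreal ((1/4) ^ k)" if "n \<ge> r k" for n k
  proof -
    have "(\<integral>\<^sup>+x. ennreal ((cmod (f n x - g x))\<^sup>2) \<partial>M)
        = (\<integral>\<^sup>+x. liminf (\<lambda>m. ennreal ((cmod (f n x - f (s m) x))\<^sup>2)) \<partial>M)"
    proof (rule nn_integral_cong_AE)
      show "AE x in M. ennreal ((cmod (f n x - g x))\<^sup>2)
          = liminf (\<lambda>m. ennreal ((cmod (f n x - f (s m) x))\<^sup>2))"
        using conv
      proof eventually_elim
        case (elim x)
        then have "(\<lambda>m. f (s m) x) \<longlonglongrightarrow> g x"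
          unfolding g_def by (simp add: convergent_LIMSEQ_iff)
        then have "(\<lambda>m. ennreal ((cmod (f n x - f (s m) x))\<^sup>2)) \<longlonglongrightarrow> ennreal ((cmod (f n x - g x))\<^sup>2)"
          by (intro tendsto_intros)
        then show ?case
          by (rule lim_imp_Liminf[OF sequentially_bot, symmetric])
      qed
    qed
    also have "\<dots> \<le> liminf (\<lambda>m. \<integral>\<^sup>+x. ennreal ((cmod (f n x - f (s m) x))\<^sup>2) \<partial>M)"
      by (rule nn_integral_liminf) measurable
    also have "\<dots> \<le> liminf (\<lambda>m. ennreal ((1/4) ^ k))"
    proof (intro Liminf_mono eventually_sequentiallyI[of k])
      fix m assume "k \<le> m"
      then show "(\<integral>\<^sup>+x. ennreal ((cmod (f n x - f (s m) x))\<^sup>2) \<partial>M) \<le> ennreal ((1/4) ^ k)"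
        unfolding nn using r[OF that s] by (intro ennreal_leI) (auto intro: less_imp_le)
    qed
    also have "\<dots> = ennreal ((1/4) ^ k)"
      by (simp add: Liminf_const)
    finally show ?thesis .
  qed
  \<comment> \<open>Square integrability of \<open>g\<close> comes from writing it as
    \<open>f (r 0) - (f (r 0) - g)\<close>; the bound for \<open>k = 0\<close> controls the second
    term.\<close>
  have diff: "integrable M (\<lambda>x. (cmod (f (r 0) x - g x))\<^sup>2)"
    using le_less_trans[OF Fatou[of 0 "r 0"] ennreal_less_top] by (intro integrableI_bounded) simp_all
  have gint: "integrable M (\<lambda>x. (cmod (g x))\<^sup>2)"
    using integrable_square_diff[OF _ _ int[of "r 0"] diff] by simp
  have "(\<lambda>n. \<integral>x. (cmod (f n x - g x))\<^sup>2 \<partial>M) \<longlonglongrightarrow> 0"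
  proof (rule LIMSEQ_I)
    fix e :: real assume "e > 0"
    then obtain k where k: "(1/4) ^ k < e"
      using real_arch_pow_inv[of e "1/4"] by auto
    have "norm ((\<integral>x. (cmod (f n x - g x))\<^sup>2 \<partial>M) - 0) < e" if "n \<ge> r k" for n
    proof -
      have "ennreal (\<integral>x. (cmod (f n x - g x))\<^sup>2 \<partial>M) \<le> ennreal ((1/4) ^ k)"
        using Fatou[OF that] integrable_square_diff[OF _ _ int gint, of n]
        by (subst (asm) nn_integral_eq_integral) auto
      then show ?thesis using k by (subst (asm) ennreal_le_iff) auto
    qed
    then show "\<exists>N. \<forall>n\<ge>N. norm ((\<integral>x. (cmod (f n x - g x))\<^sup>2 \<partial>M) - 0) < e" by blast
  qed
  with g gint that show thesis by blast
qed

section \<open>The semi-discrete Fourier transform\<close>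

text \<open>Restricting Lebesgue measure to the interval turns set integrals into ordinary integrals
  over a finite measure, to which the L2 facts above apply.\<close>

definition freq_measure :: "real \<Rightarrow> real measure" where
  "freq_measure h = restrict_space lborel (freq_interval h)"

definition grid_char :: "real \<Rightarrow> int \<Rightarrow> real \<Rightarrow> complex" where
  "grid_char h j \<xi> = exp (\<i> * of_real (\<xi> * grid_point h j))"

text \<open>The forward kernel is written as the character of index \<open>- k\<close>, so that
  products and conjugates reduce to index arithmetic.\<close>

definition partial_sdft :: "real \<Rightarrow> (int \<Rightarrow> real) \<Rightarrow> nat \<Rightarrow> real \<Rightarrow> complex" where
  "partial_sdft h v N \<xi> = of_real h * (\<Sum>k\<in>{- int N..int N}. grid_char h (- k) \<xi> * of_real (v k))"

section \<open>Transforms and their inverses as integrals over \<open>freq_measure\<close>\<close>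

lemma freq_interval_borel [measurable, simp]: "freq_interval h \<in> sets borel"
  by (simp add: freq_interval_def)

lemma set_integrable_freq_iff:
  fixes f :: "real \<Rightarrow> 'b::{banach, second_countable_topology}"
  shows "set_integrable lborel (freq_interval h) f \<longleftrightarrow> integrable (freq_measure h) f"
  by (simp add: set_integrable_def freq_measure_def integrable_restrict_space)

lemma set_integral_freq_eq:
  fixes f :: "real \<Rightarrow> 'b::{banach, second_countable_topology}"
  shows "(LINT \<xi>:freq_interval h|lborel. f \<xi>) = integral\<^sup>L (freq_measure h) f"
  by (simp add: set_lebesgue_integral_def freq_measure_def integral_restrict_space)

lemma square_integrable_on_freq_iff:
  "square_integrable_on g (freq_interval h) \<longleftrightarrow>
     g \<in> borel_measurable (freq_measure h) \<and> integrable (freq_measure h) (\<lambda>\<xi>. (cmod (g \<xi>))\<^sup>2)"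
  by (simp add: square_integrable_on_def set_integrable_freq_iff set_borel_measurable_def
      freq_measure_def borel_measurable_restrict_space_iff)

lemma is_sdft_iff:
  "is_sdft h v g \<longleftrightarrow>
     g \<in> borel_measurable (freq_measure h) \<and> integrable (freq_measure h) (\<lambda>\<xi>. (cmod (g \<xi>))\<^sup>2) \<and>
     (\<lambda>N. \<integral>\<xi>. (cmod (partial_sdft h v N \<xi> - g \<xi>))\<^sup>2 \<partial>freq_measure h) \<longlonglongrightarrow> 0"
  by (simp add: is_sdft_def square_integrable_on_freq_iff set_integral_freq_eq partial_sdft_def
      sym_partial_sum_def grid_char_def grid_point_def)

lemma inverse_sdft_eq:
  "inverse_sdft h g j = 1 / (2 * of_real pi) * (\<integral>\<xi>. grid_char h j \<xi> * g \<xi> \<partial>freq_measure h)"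
  by (simp add: inverse_sdft_def set_integral_freq_eq grid_char_def)

lemma finite_measure_freq: "finite_measure (freq_measure h)"
  by (rule finite_measureI)
     (simp add: freq_measure_def emeasure_restrict_space freq_interval_def emeasure_lborel_Icc_eq)

lemma continuous_on_grid_char: "continuous_on A (grid_char h j)"
  unfolding grid_char_def by (intro continuous_intros)

lemma grid_char_measurable [measurable]: "grid_char h j \<in> borel_measurable (freq_measure h)"
  unfolding freq_measure_def
  by (rule measurable_restrict_space1)
     (simp add: borel_measurable_continuous_onI[OF continuous_on_grid_char])

lemma partial_sdft_measurable [measurable]: "partial_sdft h v N \<in> borel_measurable (freq_measure h)"
  unfolding partial_sdft_def by measurable

lemma cmod_grid_char [simp]: "cmod (grid_char h j \<xi>) = 1"
  unfolding grid_char_def by simp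

lemma grid_char_mult: "grid_char h j \<xi> * grid_char h k \<xi> = grid_char h (j + k) \<xi>"
  unfolding grid_char_def grid_point_def by (simp add: exp_add[symmetric] algebra_simps)

lemma cnj_grid_char: "cnj (grid_char h j \<xi>) = grid_char h (- j) \<xi>"
  unfolding grid_char_def grid_point_def by (simp add: exp_cnj)

section \<open>Orthogonality of the characters and Parseval's identity\<close>

lemma integrable_grid_char: "integrable (freq_measure h) (grid_char h j)"
  by (rule finite_measure.integrable_const_bound[OF finite_measure_freq, where B = 1]) auto

text \<open>Orthogonality of the characters: for \<open>j \<noteq> 0\<close> the antiderivative
  takes equal values at the two endpoints. Parseval and inversion both rest on this.\<close>

lemma integral_grid_char:
  assumes "h > 0"
  shows "(\<integral>\<xi>. grid_char h j \<xi> \<partial>freq_measure h) = (if j = 0 then of_real (2 * pi / h) else 0)"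
proof (cases "j = 0")
  case True
  then show ?thesis
    using assms
    by (simp add: grid_char_def grid_point_def freq_measure_def measure_restrict_space freq_interval_def
        scaleR_conv_of_real)
next
  case False
  define c :: complex where "c = \<i> * of_real (of_int j * h)"
  have c: "c \<noteq> 0" using False assms by (simp add: c_def)
  have eq: "grid_char h j \<xi> = exp (c * of_real \<xi>)" for \<xi>
    by (simp add: grid_char_def grid_point_def c_def algebra_simps)
  have "(\<integral>\<xi>. grid_char h j \<xi> \<partial>freq_measure h)
      = (\<integral>\<xi>. indicator {- pi / h..pi / h} \<xi> *\<^sub>R grid_char h j \<xi> \<partial>lborel)"
    by (simp add: freq_measure_def integral_restrict_space freq_interval_def)
  also have "\<dots> = exp (c * of_real (pi / h)) / c - exp (c * of_real (- pi / h)) / c"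
  proof (rule integral_FTC_atLeastAtMost)
    show "- pi / h \<le> pi / h" using assms by (simp add: field_simps)
    show "continuous_on {- pi / h..pi / h} (grid_char h j)" by (rule continuous_on_grid_char)
    fix \<xi>
    have "((\<lambda>z. exp (c * z) / c) has_field_derivative exp (c * of_real \<xi>)) (at (of_real \<xi>))"
      using c by (auto intro!: derivative_eq_intros)
    then show "((\<lambda>\<xi>. exp (c * of_real \<xi>) / c) has_vector_derivative grid_char h j \<xi>)
        (at \<xi> within {- pi / h..pi / h})"
      unfolding eq by (intro has_vector_derivative_real_field)
  qed
  \<comment> \<open>The interval has length \<open>2 * pi / h\<close>, so the exponent changes by
    exactly j periods of the exponential.\<close>
  also have "c * of_real (pi / h) = c * of_real (- pi / h) + (2 * of_int j * pi) * \<i>"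
    using assms by (simp add: c_def field_simps)
  also have "exp (c * of_real (- pi / h) + (2 * of_int j * pi) * \<i>) = exp (c * of_real (- pi / h))"
    by (subst exp_eq) (auto intro!: exI[of _ j])
  finally show ?thesis using False by simp
qed

text \<open>Parseval for finite sums: the squared modulus expands into a double sum of characters
  \<open>l - k\<close>, of which only the diagonal survives integration, and
  \<open>h\<^sup>2 * (2 * pi / h) = 2 * pi * h\<close>. Since \<open>v\<close> is real, conjugation
  affects only the characters. The index set is arbitrary so that differences of windows are
  covered.\<close>

lemma integral_norm_trig_sum:
  assumes "h > 0" "finite A"
  shows "(\<integral>\<xi>. (cmod (of_real h * (\<Sum>k\<in>A. grid_char h (- k) \<xi> * of_real (v k))))\<^sup>2 \<partial>freq_measure h)
    = 2 * pi * h * (\<Sum>k\<in>A. (v k)\<^sup>2)"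
proof -
  have eq: "complex_of_real ((cmod (of_real h * (\<Sum>k\<in>A. grid_char h (- k) \<xi> * of_real (v k))))\<^sup>2)
    = (\<Sum>k\<in>A. \<Sum>l\<in>A. of_real (h\<^sup>2 * v k * v l) * grid_char h (l - k) \<xi>)" for \<xi>
  proof -
    have "complex_of_real ((cmod (of_real h * (\<Sum>k\<in>A. grid_char h (- k) \<xi> * of_real (v k))))\<^sup>2)
      = of_real (h\<^sup>2) * ((\<Sum>k\<in>A. grid_char h (- k) \<xi> * of_real (v k)) * (\<Sum>l\<in>A. grid_char h l \<xi> * of_real (v l)))"
      unfolding complex_norm_square by (simp add: power2_eq_square cnj_grid_char)
    also have "\<dots> = (\<Sum>k\<in>A. \<Sum>l\<in>A. of_real (h\<^sup>2 * v k * v l) * (grid_char h l \<xi> * grid_char h (- k) \<xi>))"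
      unfolding sum_product by (simp add: sum_distrib_left mult_ac)
    finally show ?thesis
      unfolding grid_char_mult by simp
  qed
  have "complex_of_real (\<integral>\<xi>. (cmod (of_real h * (\<Sum>k\<in>A. grid_char h (- k) \<xi> * of_real (v k))))\<^sup>2 \<partial>freq_measure h)
     = (\<integral>\<xi>. (\<Sum>k\<in>A. \<Sum>l\<in>A. of_real (h\<^sup>2 * v k * v l) * grid_char h (l - k) \<xi>) \<partial>freq_measure h)"
    unfolding integral_complex_of_real[symmetric] eq ..
  also have "\<dots> = (\<Sum>k\<in>A. \<Sum>l\<in>A. of_real (h\<^sup>2 * v k * v l) * (\<integral>\<xi>. grid_char h (l - k) \<xi> \<partial>freq_measure h))"
    by (simp add: integrable_grid_char)
  also have "\<dots> = (\<Sum>k\<in>A. \<Sum>l\<in>A. if l = k then of_real (h\<^sup>2 * v k * v l * (2 * pi / h)) else 0)"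
    using assms by (intro sum.cong refl) (simp add: integral_grid_char)
  also have "\<dots> = of_real (2 * pi * h * (\<Sum>k\<in>A. (v k)\<^sup>2))"
    using assms by (simp add: sum_distrib_left power2_eq_square field_simps)
  finally show ?thesis
    unfolding of_real_eq_iff .
qed

lemma integrable_norm_partial_sdft:
  "integrable (freq_measure h) (\<lambda>\<xi>. (cmod (partial_sdft h v N \<xi>))\<^sup>2)"
proof (rule finite_measure.integrable_const_bound[OF finite_measure_freq, where B = "(\<bar>h\<bar> * (\<Sum>k\<in>{- int N..int N}. \<bar>v k\<bar>))\<^sup>2"])
  have "cmod (\<Sum>k\<in>{- int N..int N}. grid_char h (- k) \<xi> * of_real (v k)) \<le> (\<Sum>k\<in>{- int N..int N}. \<bar>v k\<bar>)" for \<xi>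
    by (rule order_trans[OF norm_sum]) (simp add: norm_mult)
  then have "cmod (partial_sdft h v N \<xi>) \<le> \<bar>h\<bar> * (\<Sum>k\<in>{- int N..int N}. \<bar>v k\<bar>)" for \<xi>
    by (simp add: partial_sdft_def norm_mult mult_left_mono)
  then show "AE \<xi> in freq_measure h. norm ((cmod (partial_sdft h v N \<xi>))\<^sup>2)
      \<le> (\<bar>h\<bar> * (\<Sum>k\<in>{- int N..int N}. \<bar>v k\<bar>))\<^sup>2"
    by (simp add: power_mono)
qed measurable

text \<open>The windows are nested, so the difference of two partial sums is, up to sign, a finite
  sum over the indices in the larger window only. The absolute value makes the formula symmetric in
  m and n, which permits assuming \<open>m \<le> n\<close>.\<close>

lemma integral_norm_partial_sdft_diff:
  assumes "h > 0"
  shows "(\<integral>\<xi>. (cmod (partial_sdft h v m \<xi> - partial_sdft h v n \<xi>))\<^sup>2 \<partial>freq_measure h)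
    = 2 * pi * h * \<bar>(\<Sum>k\<in>{- int m..int m}. (v k)\<^sup>2) - (\<Sum>k\<in>{- int n..int n}. (v k)\<^sup>2)\<bar>"
proof (induction m n rule: linorder_wlog)
  case (le m n)
  let ?A = "{- int n..int n} - {- int m..int m}"
  have *: "(\<Sum>k\<in>?A. f k) = (\<Sum>k\<in>{- int n..int n}. f k) - (\<Sum>k\<in>{- int m..int m}. f k)"
    for f :: "int \<Rightarrow> 'b::ab_group_add"
    using le by (intro sum_diff) auto
  have "cmod (partial_sdft h v m \<xi> - partial_sdft h v n \<xi>)
      = cmod (of_real h * (\<Sum>k\<in>?A. grid_char h (- k) \<xi> * of_real (v k)))" for \<xi>
    unfolding * partial_sdft_def by (simp add: norm_minus_commute right_diff_distrib)
  moreover have "\<bar>(\<Sum>k\<in>{- int m..int m}. (v k)\<^sup>2) - (\<Sum>k\<in>{- int n..int n}. (v k)\<^sup>2)\<bar> = (\<Sum>k\<in>?A. (v k)\<^sup>2)"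
    using *[of "\<lambda>k. (v k)\<^sup>2"] sum_nonneg[of ?A "\<lambda>k. (v k)\<^sup>2"] by simp
  ultimately show ?case
    using integral_norm_trig_sum[OF assms, of ?A v] by simp
next
  case (sym m n)
  then show ?case by (simp add: norm_minus_commute abs_minus_commute)
qed

section \<open>Existence of the transform of an \<open>ell2\<close> sequence\<close>

lemma convergent_ell2_partial_sums:
  assumes "h > 0" "v \<in> ell2 h"
  shows "convergent (\<lambda>N. \<Sum>k\<in>{- int N..int N}. (v k)\<^sup>2)"
proof -
  have "(\<lambda>k. h * (v k)\<^sup>2) summable_on UNIV"
    using assms(2) by (simp add: ell2_def)
  then have sm: "(\<lambda>k. (v k)\<^sup>2) summable_on UNIV"
    using assms(1) by (simp add: summable_on_cmult_right')
  show ?thesis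
  \<comment> \<open>Sums of squares increase with the window and are bounded by the unconditional
    sum.\<close>
  proof (rule Bseq_mono_convergent)
    show "Bseq (\<lambda>N. \<Sum>k\<in>{- int N..int N}. (v k)\<^sup>2)"
      using finite_sum_le_infsum[OF sm]
      by (intro BseqI'[where K = "infsum (\<lambda>k. (v k)\<^sup>2) UNIV"]) (simp add: sum_nonneg)
  qed (auto intro!: sum_mono2)
qed

text \<open>Parseval turns the Cauchy property of the sums of squares into the L2 Cauchy property of
  the partial transforms. Completeness supplies a limit, so the choice in \<open>sdft\<close>
  selects an actual transform.\<close>

lemma is_sdft_sdft:
  assumes "h > 0" "v \<in> ell2 h"
  shows "is_sdft h v (sdft h v)"
proof -
  have "\<exists>N. \<forall>m\<ge>N. \<forall>n\<ge>N.
      (\<integral>\<xi>. (cmod (partial_sdft h v m \<xi> - partial_sdft h v n \<xi>))\<^sup>2 \<partial>freq_measure h) < e" if "e > 0" for e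
  proof -
    have "Cauchy (\<lambda>N. \<Sum>k\<in>{- int N..int N}. (v k)\<^sup>2)"
      using convergent_ell2_partial_sums[OF assms] by (simp add: Cauchy_convergent_iff)
    moreover have "e / (2 * pi * h) > 0" using that assms(1) by simp
    ultimately obtain N where "\<forall>m\<ge>N. \<forall>n\<ge>N.
        \<bar>(\<Sum>k\<in>{- int m..int m}. (v k)\<^sup>2) - (\<Sum>k\<in>{- int n..int n}. (v k)\<^sup>2)\<bar> < e / (2 * pi * h)"
      unfolding Cauchy_iff real_norm_def by blast
    then show ?thesis
      using assms(1) unfolding integral_norm_partial_sdft_diff[OF assms(1)]
      by (intro exI[of _ N]) (simp add: pos_less_divide_eq mult_ac)
  qed
  then obtain g where "g \<in> borel_measurable (freq_measure h)" "integrable (freq_measure h) (\<lambda>\<xi>. (cmod (g \<xi>))\<^sup>2)"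
    "(\<lambda>N. \<integral>\<xi>. (cmod (partial_sdft h v N \<xi> - g \<xi>))\<^sup>2 \<partial>freq_measure h) \<longlonglongrightarrow> 0"
    using finite_measure.L2_complete[OF finite_measure_freq, where f = "partial_sdft h v",
        OF partial_sdft_measurable integrable_norm_partial_sdft]
    by blast
  then have "is_sdft h v g"
    by (simp add: is_sdft_iff)
  then show ?thesis
    unfolding sdft_def by (rule someI[of "is_sdft h v"])
qed

section \<open>Inversion and convolution\<close>

text \<open>Common source of the inversion formula and of the convolution formula, obtained by
  different choices of \<open>g\<close>. L2 continuity allows \<open>f\<close> to be replaced by its
  partial sums, which are then integrated against \<open>g\<close> term by term. At index 0 the
  character is 1, so the limit is the plain integral over \<open>2 * pi\<close>.\<close>

lemma tendsto_inverse_sdft: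
  assumes v: "is_sdft h v f"
    and g: "g \<in> borel_measurable (freq_measure h)" "integrable (freq_measure h) (\<lambda>\<xi>. (cmod (g \<xi>))\<^sup>2)"
  shows "(\<lambda>N. of_real h * (\<Sum>k\<in>{- int N..int N}. of_real (v k) * inverse_sdft h g (- k)))
    \<longlonglongrightarrow> inverse_sdft h (\<lambda>\<xi>. f \<xi> * g \<xi>) 0"
proof -
  note [measurable] = g(1)
  have int: "integrable (freq_measure h) (\<lambda>\<xi>. grid_char h k \<xi> * g \<xi>)" for k
    using g finite_measure.integrable_const[OF finite_measure_freq]
    by (intro integrable_mult_of_square_integrable) auto
  have "(\<lambda>N. \<integral>\<xi>. partial_sdft h v N \<xi> * g \<xi> \<partial>freq_measure h)
      \<longlonglongrightarrow> (\<integral>\<xi>. f \<xi> * g \<xi> \<partial>freq_measure h)"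
    using v g by (intro tendsto_integral_mult_L2) (auto simp: is_sdft_iff integrable_norm_partial_sdft)
  moreover have "(\<integral>\<xi>. partial_sdft h v N \<xi> * g \<xi> \<partial>freq_measure h) =
      of_real h * (\<Sum>k\<in>{- int N..int N}. of_real (v k) * (\<integral>\<xi>. grid_char h (- k) \<xi> * g \<xi> \<partial>freq_measure h))" for N
  proof -
    have "partial_sdft h v N \<xi> * g \<xi>
        = of_real h * (\<Sum>k\<in>{- int N..int N}. of_real (v k) * (grid_char h (- k) \<xi> * g \<xi>))" for \<xi>
      by (simp add: partial_sdft_def sum_distrib_right sum_distrib_left mult_ac)
    then show ?thesis using int by simp
  qed
  ultimately have "(\<lambda>N. 1 / (2 * of_real pi) *
      (of_real h * (\<Sum>k\<in>{- int N..int N}. of_real (v k) * (\<integral>\<xi>. grid_char h (- k) \<xi> * g \<xi> \<partial>freq_measure h))))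
      \<longlonglongrightarrow> 1 / (2 * of_real pi) * (\<integral>\<xi>. f \<xi> * g \<xi> \<partial>freq_measure h)"
    by (intro tendsto_mult_left) simp
  then show ?thesis
    by (simp add: inverse_sdft_eq grid_char_def grid_point_def sum_distrib_left mult_ac)
qed

text \<open>Modulation in frequency is translation on the grid; this carries results at index 0 to
  an arbitrary index.\<close>

lemma inverse_sdft_grid_char_mult:
  "inverse_sdft h (\<lambda>\<xi>. grid_char h j \<xi> * g \<xi>) k = inverse_sdft h g (k + j)"
  by (simp add: inverse_sdft_eq mult.assoc[symmetric] grid_char_mult)

text \<open>Testing against the character of index j makes the coefficients a Kronecker delta
  divided by h, so the approximating sums are constant as soon as the window contains j.\<close>

lemma inverse_sdft_of_sdft:
  assumes "h > 0" "is_sdft h v f"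
  shows "inverse_sdft h f j = of_real (v j)"
proof -
  have char: "inverse_sdft h (grid_char h j) (- k) = (if k = j then 1 / of_real h else 0)" for k
    using assms(1) by (simp add: inverse_sdft_eq grid_char_mult integral_grid_char)
  have "(\<lambda>N. of_real h * (\<Sum>k\<in>{- int N..int N}. of_real (v k) * inverse_sdft h (grid_char h j) (- k)))
      \<longlonglongrightarrow> inverse_sdft h (\<lambda>\<xi>. f \<xi> * grid_char h j \<xi>) 0"
    using assms finite_measure.integrable_const[OF finite_measure_freq]
    by (intro tendsto_inverse_sdft) auto
  moreover have "\<forall>\<^sub>F N in sequentially.
      of_real h * (\<Sum>k\<in>{- int N..int N}. of_real (v k) * inverse_sdft h (grid_char h j) (- k)) = of_real (v j)"
  proof (rule eventually_sequentiallyI[of "nat \<bar>j\<bar>"])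
    fix N assume "nat \<bar>j\<bar> \<le> N"
    then have "j \<in> {- int N..int N}" by auto
    then show "of_real h * (\<Sum>k\<in>{- int N..int N}. of_real (v k) * inverse_sdft h (grid_char h j) (- k)) = of_real (v j)"
      using assms(1) unfolding char by (simp add: if_distrib[of "(*) _"] cong: if_cong)
  qed
  ultimately have "inverse_sdft h (\<lambda>\<xi>. f \<xi> * grid_char h j \<xi>) 0 = of_real (v j)"
    by (intro LIMSEQ_unique[OF _ tendsto_eventually])
  then show ?thesis
    using inverse_sdft_grid_char_mult[of h j f 0] by (simp add: mult.commute)
qed

text \<open>The test function is \<open>f\<close> times the character of index j, whose inverse
  transform at \<open>- k\<close> is \<open>u (j - k)\<close>. Only \<open>g\<close> is
  approximated, so the approximants are exactly the symmetric partial sums.\<close>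

lemma tendsto_convolution_inverse_sdft:
  assumes "h > 0" "is_sdft h u f" "is_sdft h w g"
  shows "(\<lambda>N. of_real h * (\<Sum>k\<in>{- int N..int N}. of_real (w k * u (j - k))))
    \<longlonglongrightarrow> inverse_sdft h (\<lambda>\<xi>. g \<xi> * f \<xi>) j"
proof -
  have [measurable]: "f \<in> borel_measurable (freq_measure h)"
    using assms(2) by (simp add: is_sdft_iff)
  have "(\<lambda>N. of_real h * (\<Sum>k\<in>{- int N..int N}. of_real (w k) * inverse_sdft h (\<lambda>\<xi>. grid_char h j \<xi> * f \<xi>) (- k)))
    \<longlonglongrightarrow> inverse_sdft h (\<lambda>\<xi>. g \<xi> * (grid_char h j \<xi> * f \<xi>)) 0"
    using assms by (intro tendsto_inverse_sdft) (auto simp: is_sdft_iff norm_mult)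
  moreover have "inverse_sdft h (\<lambda>\<xi>. g \<xi> * (grid_char h j \<xi> * f \<xi>)) 0 = inverse_sdft h (\<lambda>\<xi>. g \<xi> * f \<xi>) j"
    using inverse_sdft_grid_char_mult[of h j "\<lambda>\<xi>. g \<xi> * f \<xi>" 0] by (simp add: mult_ac)
  ultimately show ?thesis
    using inverse_sdft_of_sdft[OF assms(1,2)] by (simp add: inverse_sdft_grid_char_mult)
qed

section \<open>The discrete fractional Laplacian\<close>

text \<open>Every window contains 0, even for \<open>N = 0\<close>, so \<open>w 0\<close> can be
  split off. This isolates the bracket that the condition on \<open>w 0\<close> sends to zero,
  leaving minus the convolution.\<close>

lemma sym_partial_sum_frac_laplacian_term:
  "sym_partial_sum (frac_laplacian_term w u j) UNIV N
    = u j * (w 0 + sym_partial_sum w (- {0}) N) - (\<Sum>k\<in>{- int N..int N}. w k * u (j - k))"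
proof -
  have "(\<Sum>k\<in>{- int N..int N}. w k) = w 0 + (\<Sum>k\<in>{- int N..int N} - {0}. w k)"
    by (rule sum.remove) auto
  also have "{- int N..int N} - {0} = - {0} \<inter> {- int N..int N}" by auto
  finally have *: "(\<Sum>k\<in>{- int N..int N}. w k) = w 0 + sym_partial_sum w (- {0}) N"
    by (simp add: sym_partial_sum_def)
  have "sym_partial_sum (frac_laplacian_term w u j) UNIV N
      = (\<Sum>k\<in>{- int N..int N}. u j * w k - w k * u (j - k))"
    by (simp add: sym_partial_sum_def frac_laplacian_term_def algebra_simps)
  then show ?thesis
    by (simp only: sum_subtractf sum_distrib_left[symmetric] *)
qed

theorem lemma2p2:
  fixes h \<alpha> :: real and u w :: "int \<Rightarrow> real"
  assumes "h > 0"
    and "0 < \<alpha>" and "\<alpha> < 2"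
    and "u \<in> ell2 h" and "w \<in> ell2 h"
    and "\<And>k. w k = w (- k)"
    and "sym_summable w (- {0})"
    and "w 0 = - sym_sum w (- {0})"
  shows "(\<forall>j. sym_summable (frac_laplacian_term w u j) UNIV) \<and>
    set_integrable lborel (freq_interval h) (\<lambda>\<xi>. multiplier h w \<xi> * sdft h u \<xi>) \<and>
    (\<forall>j. of_real (frac_laplacian \<alpha> w u j) =
         inverse_sdft h (\<lambda>\<xi>. multiplier h w \<xi> * sdft h u \<xi>) j)"
proof -
  note u = is_sdft_sdft[OF assms(1,4)] and w = is_sdft_sdft[OF assms(1,5)]
  have weights: "(\<lambda>N. w 0 + sym_partial_sum w (- {0}) N) \<longlonglongrightarrow> 0"
  proof -
    have "sym_partial_sum w (- {0}) \<longlonglongrightarrow> sym_sum w (- {0})"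
      using assms(7) by (simp add: sym_summable_def sym_sum_def convergent_LIMSEQ_iff)
    from tendsto_add[OF tendsto_const[of "w 0"] this] show ?thesis
      using assms(8) by simp
  qed
  have mult: "multiplier h w \<xi> * sdft h u \<xi> = - (1 / of_real h) * (sdft h w \<xi> * sdft h u \<xi>)" for \<xi>
    by (simp add: multiplier_def)
  have lim: "(\<lambda>N. of_real (sym_partial_sum (frac_laplacian_term w u j) UNIV N))
      \<longlonglongrightarrow> inverse_sdft h (\<lambda>\<xi>. multiplier h w \<xi> * sdft h u \<xi>) j" for j
  proof -
    \<comment> \<open>The factor \<open>1 / h\<close> of the multiplier cancels the \<open>h\<close>
      in the forward transform, and its minus sign is that of the convolution.\<close>
    have "(\<lambda>N. complex_of_real (u j * (w 0 + sym_partial_sum w (- {0}) N))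
        - 1 / of_real h * (of_real h * (\<Sum>k\<in>{- int N..int N}. of_real (w k * u (j - k)))))
        \<longlonglongrightarrow> of_real (u j * 0) - 1 / of_real h * inverse_sdft h (\<lambda>\<xi>. sdft h w \<xi> * sdft h u \<xi>) j"
      by (intro tendsto_diff tendsto_of_real tendsto_mult_left weights
          tendsto_convolution_inverse_sdft assms(1) u w)
    moreover have "inverse_sdft h (\<lambda>\<xi>. multiplier h w \<xi> * sdft h u \<xi>) j
        = - (1 / of_real h) * inverse_sdft h (\<lambda>\<xi>. sdft h w \<xi> * sdft h u \<xi>) j"
      unfolding mult inverse_sdft_eq mult.left_commute[of "grid_char h j _"] by simp
    ultimately show ?thesis
      using assms(1) by (simp add: sym_partial_sum_frac_laplacian_term)
  qed
  \<comment> \<open>The partial sums are real, so their limit is the real part; uniqueness of limits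
    later shows that the inverse transform itself is real.\<close>
  have conv: "(\<lambda>N. sym_partial_sum (frac_laplacian_term w u j) UNIV N)
      \<longlonglongrightarrow> Re (inverse_sdft h (\<lambda>\<xi>. multiplier h w \<xi> * sdft h u \<xi>) j)" for j
    using tendsto_Re[OF lim] by simp
  have "sym_summable (frac_laplacian_term w u j) UNIV" for j
    unfolding sym_summable_def using conv by (auto simp: convergent_def)
  moreover have "of_real (frac_laplacian \<alpha> w u j)
      = inverse_sdft h (\<lambda>\<xi>. multiplier h w \<xi> * sdft h u \<xi>) j" for j
  proof -
    have "frac_laplacian \<alpha> w u j = Re (inverse_sdft h (\<lambda>\<xi>. multiplier h w \<xi> * sdft h u \<xi>) j)"
      unfolding frac_laplacian_def sym_sum_def by (rule limI[OF conv])
    then show ?thesis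
      using LIMSEQ_unique[OF tendsto_of_real[OF conv] lim] by metis
  qed
  \<comment> \<open>A product of two L2 functions is integrable. The integral in
    \<open>inverse_sdft\<close> is therefore genuine and not the default value 0 of a non-integrable
    function.\<close>
  moreover have "set_integrable lborel (freq_interval h) (\<lambda>\<xi>. multiplier h w \<xi> * sdft h u \<xi>)"
    unfolding set_integrable_freq_iff mult
    using u w by (intro integrable_mult_right integrable_mult_of_square_integrable) (auto simp: is_sdft_iff)
  ultimately show ?thesis by blast
qed

end
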